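(* For $t\in[0,1]$ and density operators $\rho,\sigma$, $$\rho\,\natural_t\,\sigma=\sigma\,\natural_{1-t}\,\rho,\qquad\text{hence}\qquad \mathsf{F}_t^{\mathrm{spec}}(\rho,\sigma)=\mathsf{F}_{1-t}^{\mathrm{spec}}(\sigma,\rho).$$
   Context: A density operator (density matrix, state) is a positive semidefinite complex $n\times n$ matrix of trace one. For positive definite $A,B$, the matrix geometric mean is $A\sharp B=A^{1/2}(A^{-1/2}BA^{-1/2})^{1/2}A^{1/2}$, and the weighted spectral mean is $A\,\natural_t\,B=(A^{-1}\sharp B)^t\,A\,(A^{-1}\sharp B)^t$ for $t\in[0,1]$. The weighted spectral fidelity of density operators $\rho,\sigma$ is $\mathsf{F}_t^{\mathrm{spec}}(\rho,\sigma)=\operatorname{Tr}(\rho\,\natural_t\,\sigma)=\operatorname{Tr}\big(\rho\,(\rho^{-1}\sharp\sigma)^{2t}\big)$. For singular density operators, inverse and fractional powers are interpreted on the support of the corresponding operator.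
   Formalization: Added hypothesis: the support projections of ρ and σ commute (automatic if either is invertible). With powers taken on supports the identity fails otherwise, e.g. for two distinct non-orthogonal pure states; commutation is necessary and sufficient for the operator identity. *)

theory Defs
  imports "Jordan_Normal_Form.Schur_Decomposition"
begin

definition hermitian_mat :: "complex mat \<Rightarrow> bool" where
  "hermitian_mat A \<longleftrightarrow> mat_adjoint A = A"

definition positive_semidefinite :: "nat \<Rightarrow> complex mat \<Rightarrow> bool" where
  "positive_semidefinite n A \<longleftrightarrow>
     A \<in> carrier_mat n n \<and> hermitian_mat A \<and>
     (\<forall>v \<in> carrier_vec n. 0 \<le> Re ((A *\<^sub>v v) \<bullet>c v))"

definition mat_trace :: "'a::comm_monoid_add mat \<Rightarrow> 'a" where
  "mat_trace A = (\<Sum>i<dim_row A. A $$ (i, i))"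

definition density_operator :: "nat \<Rightarrow> complex mat \<Rightarrow> bool" where
  "density_operator n \<rho> \<longleftrightarrow> positive_semidefinite n \<rho> \<and> mat_trace \<rho> = 1"

definition unitary_mat :: "nat \<Rightarrow> complex mat \<Rightarrow> bool" where
  "unitary_mat n U \<longleftrightarrow> U \<in> carrier_mat n n \<and> mat_adjoint U * U = 1\<^sub>m n"

text \<open>Spectral decomposition \<open>A = U D U\<^sup>*\<close> with real eigenvalues \<open>d 0, \<dots>, d (n - 1)\<close>,
  repeated according to multiplicity.\<close>

definition spectral_decomposition :: "complex mat \<Rightarrow> complex mat \<Rightarrow> (nat \<Rightarrow> real) \<Rightarrow> bool" where
  "spectral_decomposition A U d \<longleftrightarrow>
     unitary_mat (dim_row A) U \<and>
     A = U * mat_diag (dim_row A) (\<lambda>i. complex_of_real (d i)) * mat_adjoint U"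

text \<open>Real powers of a positive semidefinite matrix by functional calculus.  Since
  \<open>0 powr s = 0\<close> for every \<open>s\<close> (negative \<open>s\<close> and \<open>s = 0\<close> included), the power is taken on
  the support of \<open>A\<close> and is zero on the kernel.  In particular \<open>mat_powr A (-1)\<close> is the
  inverse on the support (the ordinary inverse if \<open>A\<close> is invertible), and \<open>mat_powr A 0\<close>
  is the orthogonal projection onto the support (the identity if \<open>A\<close> is invertible).
  The value does not depend on the decomposition chosen, see \<open>mat_powr_eq\<close> below.\<close>

definition mat_powr :: "complex mat \<Rightarrow> real \<Rightarrow> complex mat" where
  "mat_powr A s =
     (THE B. \<exists>U d. spectral_decomposition A U d \<and>
        B = U * mat_diag (dim_row A) (\<lambda>i. complex_of_real (d i powr s)) * mat_adjoint U)"

text \<open>With powers taken on the support, the spectral mean of singular states is not symmetric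
  under exchanging the arguments and \<open>t\<close> with \<open>1 - t\<close> in general: for rank-one projections
  \<open>\<rho> = |x><x|\<close> and \<open>\<sigma> = |y><y|\<close> with \<open>0 < c = |<x|y>| < 1\<close> the two sides are
  \<open>c powr (2 * t)\<close> times \<open>\<rho>\<close> and \<open>c powr (2 * (1 - t))\<close> times \<open>\<sigma>\<close>.
  The ranges of the two sides are the ranges of \<open>P Q\<close> and \<open>Q P\<close>, where \<open>P\<close> and \<open>Q\<close> are the
  support projections, so the symmetry can only hold if \<open>P\<close> and \<open>Q\<close> commute.\<close>

definition support_proj :: "complex mat \<Rightarrow> complex mat" where
  "support_proj A = mat_powr A 0"

definition geometric_mean :: "complex mat \<Rightarrow> complex mat \<Rightarrow> complex mat" where
  "geometric_mean A B =
     mat_powr A (1/2) * mat_powr (mat_powr A (-1/2) * B * mat_powr A (-1/2)) (1/2) * mat_powr A (1/2)"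

definition spectral_mean :: "real \<Rightarrow> complex mat \<Rightarrow> complex mat \<Rightarrow> complex mat" where
  "spectral_mean t A B =
     (let G = geometric_mean (mat_powr A (-1)) B in mat_powr G t * A * mat_powr G t)"

definition spectral_fidelity :: "real \<Rightarrow> complex mat \<Rightarrow> complex mat \<Rightarrow> complex" where
  "spectral_fidelity t \<rho> \<sigma> = mat_trace (spectral_mean t \<rho> \<sigma>)"

lemma mat_adjoint_carrier: "A \<in> carrier_mat n m \<Longrightarrow> mat_adjoint A \<in> carrier_mat m n"
  unfolding mat_adjoint_def by auto

lemma mat_powr_unique:
  assumes 1: "spectral_decomposition A U d" and 2: "spectral_decomposition A V e"
  shows "U * mat_diag (dim_row A) (\<lambda>i. complex_of_real (d i powr s)) * mat_adjoint U =
         V * mat_diag (dim_row A) (\<lambda>i. complex_of_real (e i powr s)) * mat_adjoint V"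
proof -
  define n where "n = dim_row A"
  define U' V' where "U' = mat_adjoint U" and "V' = mat_adjoint V"
  define D where "D f = mat_diag n (\<lambda>i. complex_of_real (f i))" for f :: "nat \<Rightarrow> real"
  define ds es where "ds i = d i powr s" and "es i = e i powr s" for i
  have U: "U \<in> carrier_mat n n" "U' * U = 1\<^sub>m n" and V: "V \<in> carrier_mat n n" "V' * V = 1\<^sub>m n"
    using 1 2 by (auto simp: spectral_decomposition_def unitary_mat_def n_def U'_def V'_def)
  have U': "U' \<in> carrier_mat n n" and V': "V' \<in> carrier_mat n n"
    using U V by (auto simp: U'_def V'_def intro: mat_adjoint_carrier)
  have UU: "U * U' = 1\<^sub>m n" and VV: "V * V' = 1\<^sub>m n"
    using U V U' V' by (auto intro: mat_mult_left_right_inverse)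
  have D [simp]: "D f \<in> carrier_mat n n" for f by (simp add: D_def)
  have eq: "U * D d * U' = V * D e * V'"
    using 1 2 by (simp add: spectral_decomposition_def n_def D_def U'_def V'_def)
  note [simp] = U U' V V' UU VV right_mult_one_mat[OF D] right_mult_one_mat[OF V']
  have cancel: "U' * (U * X) = X" "V' * (V * X) = X" "V * (V' * X) = X"
    if "X \<in> carrier_mat n n" for X
    using that by (simp_all add: assoc_mult_mat[of _ n n _ n _ n, symmetric])
  define W where "W = V' * U"
  have W: "W \<in> carrier_mat n n" unfolding W_def by (rule mult_carrier_mat[OF V' U(1)])
  have "W * D d = V' * (U * D d * U') * U"
    by (simp add: W_def assoc_mult_mat[of _ n n _ n _ n] mult_carrier_mat[of _ n n])
  also have "\<dots> = V' * (V * D e * V') * U" by (simp add: eq)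
  also have "\<dots> = D e * W"
    by (simp add: W_def assoc_mult_mat[of _ n n _ n _ n] mult_carrier_mat[of _ n n] cancel)
  finally have WD: "W * D d = D e * W" .
  have "W $$ (i,j) * complex_of_real (d j) = complex_of_real (e i) * W $$ (i,j)"
    if "i < n" "j < n" for i j
    using arg_cong[OF WD, of "\<lambda>M. M $$ (i,j)"] that W
    by (simp add: D_def mat_diag_mult_left[OF W] mat_diag_mult_right[OF W])
  hence "W $$ (i,j) * complex_of_real (ds j) = complex_of_real (es i) * W $$ (i,j)"
    if "i < n" "j < n" for i j
    using that unfolding ds_def es_def by (cases "W $$ (i,j) = 0") (force simp: mult.commute)+
  hence Ws: "W * D ds = D es * W"
    using W by (intro eq_matI) (auto simp: D_def mat_diag_mult_left[OF W] mat_diag_mult_right[OF W])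
  have "U * D ds * U' = V * (W * D ds) * U'"
    by (simp add: W_def assoc_mult_mat[of _ n n _ n _ n] mult_carrier_mat[of _ n n] cancel)
  also have "\<dots> = V * (D es * W) * U'" by (simp only: Ws)
  also have "\<dots> = V * D es * V'"
    by (simp add: W_def assoc_mult_mat[of _ n n _ n _ n] mult_carrier_mat[of _ n n])
  finally show ?thesis by (simp add: D_def ds_def es_def U'_def V'_def n_def)
qed

lemma mat_powr_eq:
  assumes "spectral_decomposition A U d"
  shows "mat_powr A s =
    U * mat_diag (dim_row A) (\<lambda>i. complex_of_real (d i powr s)) * mat_adjoint U"
  unfolding mat_powr_def
  using assms by (intro the_equality) (auto intro: mat_powr_unique)

end

theory Submission
  imports Defs "Jordan_Normal_Form.Spectral_Radius"
begin

text \<open>Write \<open>A # B\<close> for the geometric mean; the spectral mean of \<open>A\<close> and \<open>B\<close> with weight \<open>t\<close> is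
  \<open>G^t A G^t\<close>, where \<open>G = A^(-1) # B\<close>.  For invertible matrices, \<open>G\<close> is the unique positive
  solution of the Riccati equation \<open>G A G = B\<close>.  This equation is equivalent to \<open>K B K = A\<close> for
  \<open>K = G^(-1)\<close>, so \<open>B^(-1) # A = K\<close>.  Substituting \<open>K B K\<close> for \<open>A\<close> gives
  \<open>G^t A G^t = (G^t K) B (K G^t) = K^(1-t) B K^(1-t)\<close>, the spectral mean of \<open>B\<close> and \<open>A\<close> with
  weight \<open>1 - t\<close>.

  For singular matrices, let \<open>P\<close> and \<open>Q\<close> be the support projections of \<open>A\<close> and \<open>B\<close>.  The Riccati
  equation becomes \<open>G A G = P B P\<close> (\<open>geometric_mean_inverse_riccati\<close>).  If \<open>P\<close> and \<open>Q\<close> commute,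
  comparing the kernels of both sides (\<open>mult_eq_if_adjoint_mult_self_eq\<close>) shows that the support
  projection of \<open>G\<close> is exactly \<open>P Q\<close>.  The inverse \<open>K\<close> of \<open>G\<close> on its support then satisfies
  \<open>K B K = Q A Q\<close>.  With \<open>b = B^(1/2)\<close> this yields \<open>(b K b)^2 = b A b\<close>, and uniqueness of positive
  square roots (\<open>psd_sqrt_unique\<close>) identifies \<open>K\<close> with \<open>B^(-1) # A\<close>.  The computation for
  invertible matrices goes through, because the powers of \<open>G\<close> absorb \<open>P\<close> and \<open>Q\<close>.

  The functional calculus rests on the spectral theorem, which gives every positive
  semidefinite matrix a unitary diagonalisation with nonnegative eigenvalues.\<close>

section \<open>Adjoints\<close>

lemma index_mat_adjoint:
  assumes "i < dim_col A" "j < dim_row A"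
  shows "mat_adjoint A $$ (i, j) = conjugate (A $$ (j, i))"
  using assms by (simp add: mat_adjoint_def mat_of_rows_def)

lemma dim_mat_adjoint [simp]:
  "dim_row (mat_adjoint A) = dim_col A" "dim_col (mat_adjoint A) = dim_row A"
  by (simp_all add: mat_adjoint_def)

lemma mat_adjoint_adjoint [simp]: "mat_adjoint (mat_adjoint A) = A"
  by (intro eq_matI) (simp_all add: index_mat_adjoint)

lemma mat_adjoint_mult:
  fixes A B :: "complex mat"
  assumes "A \<in> carrier_mat n m" "B \<in> carrier_mat m k"
  shows "mat_adjoint (A * B) = mat_adjoint B * mat_adjoint A"
  using assms by (intro eq_matI)
    (auto simp: index_mat_adjoint scalar_prod_def mult.commute intro!: sum.cong)

lemma mat_adjoint_diag_real:
  "mat_adjoint (mat_diag n (\<lambda>i. complex_of_real (d i))) = mat_diag n (\<lambda>i. complex_of_real (d i))"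
  by (intro eq_matI) (auto simp: index_mat_adjoint mat_diag_def)

lemma cscalar_prod_adjoint:
  fixes A :: "complex mat"
  assumes "A \<in> carrier_mat n m" "v \<in> carrier_vec m" "w \<in> carrier_vec n"
  shows "(A *\<^sub>v v) \<bullet>c w = v \<bullet>c (mat_adjoint A *\<^sub>v w)"
proof -
  have "(A *\<^sub>v v) \<bullet>c w = (\<Sum>i<n. \<Sum>j<m. A $$ (i,j) * v $ j * cnj (w $ i))"
    using assms by (simp add: scalar_prod_def sum_distrib_right atLeast0LessThan)
  also have "\<dots> = (\<Sum>j<m. \<Sum>i<n. A $$ (i,j) * v $ j * cnj (w $ i))"
    by (rule sum.swap)
  also have "\<dots> = v \<bullet>c (mat_adjoint A *\<^sub>v w)"
    using assms
    by (simp add: scalar_prod_def sum_distrib_left atLeast0LessThan index_mat_adjoint mult_ac)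
  finally show ?thesis .
qed

lemma adjoint_mult_self_eq_0:
  fixes X :: "complex mat"
  assumes X: "X \<in> carrier_mat n m" and zero: "mat_adjoint X * X = 0\<^sub>m m m"
  shows "X = 0\<^sub>m n m"
proof -
  have "X $$ (i, j) = 0" if ij: "i < n" "j < m" for i j
  proof -
    have "col X j \<bullet>c col X j = (mat_adjoint X * X) $$ (j, j)"
      using X ij by (simp add: scalar_prod_def index_mat_adjoint mult.commute)
    also have "\<dots> = 0"
      using ij by (simp add: zero)
    finally have "col X j = 0\<^sub>v n"
      using X by (subst (asm) conjugate_square_eq_0_vec[where n = n]) auto
    thus ?thesis
      using X ij by (metis carrier_matD index_col index_zero_vec(1))
  qed
  thus ?thesis using X by (intro eq_matI) auto
qed

text \<open>\<open>X\<^sup>* X\<close> and \<open>X\<close> have the same kernel, here applied to the columns of \<open>1 - Q\<close>.  This is how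
  information about supports is read off from a quadratic expression such as \<open>G A G\<close>.\<close>

lemma mult_eq_if_adjoint_mult_self_eq:
  fixes X :: "complex mat"
  assumes X: "X \<in> carrier_mat m n" and Q: "Q \<in> carrier_mat n n"
    and eq: "mat_adjoint X * X * Q = mat_adjoint X * X"
  shows "X * Q = X"
proof -
  define E where "E = 1\<^sub>m n - Q"
  have E: "E \<in> carrier_mat n n" using Q by (simp add: E_def minus_carrier_mat)
  note X' = mat_adjoint_carrier[OF X] and E' = mat_adjoint_carrier[OF E]
  have XX: "mat_adjoint X * X \<in> carrier_mat n n" using X X' by simp
  have YE: "Y * E = Y - Y * Q" if "Y \<in> carrier_mat k n" for Y k
    using that Q by (simp add: E_def mult_minus_distrib_mat[of _ k n _ n])
  have "mat_adjoint (X * E) * (X * E) = mat_adjoint E * (mat_adjoint X * X * E)"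
    using X X' E E' by (simp add: mat_adjoint_mult[OF X E] assoc_mult_mat[of _ n n _ m _ n]
        assoc_mult_mat[OF X' X E])
  also have "\<dots> = 0\<^sub>m n n"
    using XX by (simp add: YE[OF XX] eq right_mult_zero_mat[OF E'])
  finally have "X * E = 0\<^sub>m m n"
    using X E by - (rule adjoint_mult_self_eq_0, auto)
  hence diff: "X - X * Q = 0\<^sub>m m n" using YE[OF X] by simp
  have "X $$ (i, j) - (X * Q) $$ (i, j) = 0" if "i < m" "j < n" for i j
    using arg_cong[OF diff, of "\<lambda>Y. Y $$ (i, j)"] that X Q by simp
  thus ?thesis using X Q by (intro eq_matI) auto
qed

section \<open>The spectral theorem for Hermitian matrices\<close>

lemma unitary_matD:
  assumes "unitary_mat n U"
  shows "U \<in> carrier_mat n n" "mat_adjoint U * U = 1\<^sub>m n" "U * mat_adjoint U = 1\<^sub>m n"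
  using assms mat_mult_left_right_inverse[of "mat_adjoint U" n U]
  by (auto simp: unitary_mat_def mat_adjoint_carrier)

lemma unitary_mat_mult:
  assumes "unitary_mat n U" "unitary_mat n V"
  shows "unitary_mat n (U * V)"
proof -
  note U = unitary_matD[OF assms(1)] and V = unitary_matD[OF assms(2)]
  have "mat_adjoint (U * V) * (U * V) = mat_adjoint V * ((mat_adjoint U * U) * V)"
    by (simp only: mat_adjoint_mult[OF U(1) V(1)] assoc_mult_mat[of _ n n _ n _ n]
      mult_carrier_mat[of _ n n] mat_adjoint_carrier U(1) V(1))
  also have "\<dots> = 1\<^sub>m n" by (simp only: U(2) V(2) left_mult_one_mat[OF V(1)])
  finally show ?thesis using U V by (auto simp: unitary_mat_def intro!: mult_carrier_mat[of _ n n])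
qed

text \<open>Gram-Schmidt orthogonalisation of a basis that starts with \<open>v\<close> keeps \<open>v\<close> as first column;
  it gives orthogonal columns, and a diagonal factor on the right normalises them.\<close>

lemma unitary_with_first_column:
  fixes v :: "complex vec"
  assumes v: "v \<in> carrier_vec n" and v0: "v \<noteq> 0\<^sub>v n"
  obtains W c where "unitary_mat n W" "col W 0 = c \<cdot>\<^sub>v v"
proof -
  interpret cof_vec_space n "TYPE(complex)" .
  have n: "n > 0" using v v0 by (cases n) auto
  define b where "b = basis_completion v"
  define ws where "ws = gram_schmidt n b"
  define X where "X = mat_of_cols n ws"
  note b = basis_completion[OF v v0, folded b_def]
  from b(6,7) n obtain vs where bv: "b = v # vs" by (cases b) auto
  from gram_schmidt_result[OF b(2,4,5) refl, folded ws_def]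
  have ws: "set ws \<subseteq> carrier_vec n" "corthogonal ws" "length ws = n"
    by (auto simp: b(6))
  have hd: "hd ws = v" using gram_schmidt_hd[OF v, of vs, folded bv] by (simp add: ws_def)
  have orth: "corthogonal_mat X" using orthogonal_mat_of_cols ws unfolding X_def by blast
  have X: "X \<in> carrier_mat n n" using mat_of_cols_carrier(1)[of n ws] ws by (simp add: X_def)
  have col0: "col X 0 = v"
    using ws hd n v by (cases ws) (auto simp: X_def)
  define r where "r i = 1 / sqrt (Re (col X i \<bullet>c col X i))" for i
  define W where "W = X * mat_diag n (\<lambda>i. complex_of_real (r i))"
  have W: "W \<in> carrier_mat n n" using X by (simp add: W_def mult_carrier_mat[of _ n n])
  have Wij: "W $$ (i, j) = X $$ (i, j) * r j" if "i < n" "j < n" for i j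
    using that X by (simp add: W_def mat_diag_mult_right[OF X])
  have "(mat_adjoint W * W) $$ (i, j) = 1\<^sub>m n $$ (i, j)" if ij: "i < n" "j < n" for i j
  proof -
    have "(mat_adjoint W * W) $$ (i, j) = r i * r j * (col X j \<bullet>c col X i)"
      using X W ij
      by (simp add: scalar_prod_def index_mat_adjoint Wij sum_distrib_left mult_ac)
    also have "\<dots> = 1\<^sub>m n $$ (i, j)"
    proof (cases "i = j")
      case True
      define z where "z = col X i \<bullet>c col X i"
      have "z \<ge> 0" unfolding z_def by auto
      moreover have "z \<noteq> 0" using corthogonal_matD[OF orth, of i i] ij X by (simp add: z_def)
      ultimately have "z = complex_of_real (Re z)" "Re z > 0"
        by (auto simp: less_eq_complex_def complex_eq_iff)
      moreover from this(2) have "r i * r i * Re z = 1"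
        unfolding r_def z_def[symmetric] by (simp add: field_simps)
      ultimately have "complex_of_real (r i) * r i * z = 1"
        by (metis of_real_1 of_real_mult)
      thus ?thesis using True ij by (simp add: z_def)
    next
      case False
      thus ?thesis using corthogonal_matD[OF orth, of j i] ij X by auto
    qed
    finally show ?thesis .
  qed
  hence "mat_adjoint W * W = 1\<^sub>m n"
    using W by (intro eq_matI) auto
  hence "unitary_mat n W" using W by (simp add: unitary_mat_def)
  moreover have "col W 0 = complex_of_real (r 0) \<cdot>\<^sub>v v"
    unfolding col0[symmetric] using W X n by (intro eq_vecI) (auto simp: Wij)
  ultimately show ?thesis by (rule that)
qed

text \<open>Induction on the size.  In a unitary basis starting with an eigenvector, the first column of
  \<open>A\<close> is the eigenvalue followed by zeros.  Being Hermitian, \<open>A\<close> then has the same first row and a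
  real eigenvalue, so it splits as a direct sum of a one-by-one block and a smaller Hermitian block.\<close>

theorem hermitian_spectral_decomposition:
  assumes "A \<in> carrier_mat n n" "hermitian_mat A"
  obtains U d where "spectral_decomposition A U d"
proof -
  have "\<exists>U d. unitary_mat n U \<and> A = U * mat_diag n (\<lambda>i. complex_of_real (d i)) * mat_adjoint U"
    using assms
  proof (induction n arbitrary: A)
    case 0
    thus ?case
      by (intro exI[of _ "1\<^sub>m 0"] exI[of _ "\<lambda>_. 0"]) (auto simp: unitary_mat_def)
  next
    case (Suc m)
    define n where "n = Suc m"
    have A: "A \<in> carrier_mat n n" and hA: "mat_adjoint A = A"
      using Suc.prems by (auto simp: n_def hermitian_mat_def)
    obtain e where "e \<in> spectrum A"
      using spectrum_non_empty[OF A] by (auto simp: n_def)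
    then obtain v where v: "v \<in> carrier_vec n" "v \<noteq> 0\<^sub>v n" "A *\<^sub>v v = e \<cdot>\<^sub>v v"
      using A by (auto simp: spectrum_def eigenvalue_def eigenvector_def)
    obtain W c where uW: "unitary_mat n W" and W0: "col W 0 = c \<cdot>\<^sub>v v"
      using unitary_with_first_column[OF v(1,2)] .
    note W = unitary_matD[OF uW]
    define W' where "W' = mat_adjoint W"
    have W': "W' \<in> carrier_mat n n" using W(1) by (simp add: W'_def mat_adjoint_carrier)
    have WW: "W' * W = 1\<^sub>m n" "W * W' = 1\<^sub>m n" using W by (simp_all add: W'_def)
    define B where "B = W' * (A * W)"
    have B: "B \<in> carrier_mat n n"
      using A W W' by (simp add: B_def mult_carrier_mat[of _ n n])
    have hB: "mat_adjoint B = B"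
      using A W W' hA
      by (simp add: B_def mat_adjoint_mult[of _ n n _ n] mult_carrier_mat[of _ n n] W'_def
          assoc_mult_mat[of _ n n _ n _ n])
    have AW0: "A *\<^sub>v col W 0 = e \<cdot>\<^sub>v col W 0"
      using A v by (simp add: W0 mult_mat_vec[OF A] smult_smult_assoc mult.commute)
    have B0: "B $$ (i, 0) = (if i = 0 then e else 0)" if "i < n" for i
    proof -
      have "B $$ (i, 0) = row W' i \<bullet> col (A * W) 0"
        using that A W W' by (simp add: B_def)
      also have "col (A * W) 0 = A *\<^sub>v col W 0"
        using A W by (intro eq_vecI) (auto simp: n_def)
      also have "row W' i \<bullet> (A *\<^sub>v col W 0) = e * (row W' i \<bullet> col W 0)"
        using W W' by (simp add: AW0)
      also have "row W' i \<bullet> col W 0 = (W' * W) $$ (i, 0)"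
        using that W W' by (simp add: n_def)
      finally show ?thesis using that by (simp add: WW)
    qed
    have Bconj: "B $$ (i, j) = cnj (B $$ (j, i))" if "i < n" "j < n" for i j
      using arg_cong[OF hB, of "\<lambda>M. M $$ (i, j)"] that B by (simp add: index_mat_adjoint)
    have "e = cnj e" using Bconj[of 0 0] B0[of 0] by (simp add: n_def)
    hence e: "e = complex_of_real (Re e)" by (simp add: complex_eq_iff)
    have B0': "B $$ (0, j) = (if j = 0 then e else 0)" if "j < n" for j
      using Bconj[of 0 j] B0[of j] that \<open>e = cnj e\<close> by auto
    define C where "C = mat m m (\<lambda>(i, j). B $$ (Suc i, Suc j))"
    have C: "C \<in> carrier_mat m m" by (simp add: C_def)
    have hC: "hermitian_mat C"
      unfolding hermitian_mat_def
      by (intro eq_matI)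
        (auto simp: C_def index_mat_adjoint n_def simp flip: Bconj)
    from Suc.IH[OF C hC] obtain U d where uU: "unitary_mat m U"
      and Ceq: "C = U * mat_diag m (\<lambda>i. complex_of_real (d i)) * mat_adjoint U" by blast
    note U = unitary_matD[OF uU]
    note U' = mat_adjoint_carrier[OF U(1)]
    \<comment> \<open>The direct sum of a scalar and a matrix, an algebra homomorphism that respects adjoints.\<close>
    define bl where "bl a X = four_block_mat (mat 1 1 (\<lambda>_. a)) (0\<^sub>m 1 m) (0\<^sub>m m 1) X"
      for a :: complex and X
    have bl: "bl a X \<in> carrier_mat n n" if "X \<in> carrier_mat m m" for a X
      using that by (auto simp: bl_def n_def)
    have blm: "bl a X * bl a' X' = bl (a * a') (X * X')"
      if "X \<in> carrier_mat m m" "X' \<in> carrier_mat m m" for a a' X X'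
      using that unfolding bl_def
      by (subst mult_four_block_mat[of _ 1 1 _ m _ m _ _ 1 _ m])
        (auto intro!: cong_four_block_mat eq_matI simp: scalar_prod_def)
    have bla: "mat_adjoint (bl a X) = bl (cnj a) (mat_adjoint X)" if "X \<in> carrier_mat m m" for a X
      using that by (intro eq_matI) (auto simp: bl_def index_mat_adjoint)
    have bl1: "bl 1 (1\<^sub>m m) = 1\<^sub>m n"
      by (intro eq_matI) (auto simp: bl_def n_def)
    define f where "f i = (case i of 0 \<Rightarrow> Re e | Suc k \<Rightarrow> d k)" for i
    have Df: "mat_diag n (\<lambda>i. complex_of_real (f i)) = bl e (mat_diag m (\<lambda>i. complex_of_real (d i)))"
      using e by (intro eq_matI) (auto simp: bl_def n_def mat_diag_def f_def split: nat.split)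
    have Beq: "B = bl e C"
      using B by (intro eq_matI) (auto simp: bl_def n_def B0 B0' C_def)
    define V where "V = bl 1 U"
    have V: "V \<in> carrier_mat n n" "mat_adjoint V \<in> carrier_mat n n"
      using U(1) bl by (auto simp: V_def intro: mat_adjoint_carrier)
    have uV: "unitary_mat n V"
      using U U' V by (simp add: unitary_mat_def V_def bla blm bl1)
    have BV: "B = V * mat_diag n (\<lambda>i. complex_of_real (f i)) * mat_adjoint V"
      using U(1) U' by (simp add: Beq Ceq Df V_def bla blm mult_carrier_mat[of _ m m])
    have "A = (W * W') * A * (W * W')" using A by (simp add: WW)
    also have "\<dots> = W * B * W'"
      using A W(1) W'
      by (simp only: B_def assoc_mult_mat[of _ n n _ n _ n] mult_carrier_mat[of _ n n])
    also have "\<dots> = (W * V) * mat_diag n (\<lambda>i. complex_of_real (f i)) * mat_adjoint (W * V)"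
      using W(1) W' V
      by (simp only: BV W'_def mat_adjoint_mult[of _ n n _ n] assoc_mult_mat[of _ n n _ n _ n]
          mult_carrier_mat[of _ n n] mat_diag_dim)
    finally show ?case using unitary_mat_mult[OF uW uV] unfolding n_def by blast
  qed
  thus ?thesis using that assms(1) by (auto simp: spectral_decomposition_def)
qed

section \<open>Powers of positive semidefinite matrices\<close>

lemma psd_congruence:
  assumes Y: "positive_semidefinite n Y" and X: "X \<in> carrier_mat n m"
  shows "positive_semidefinite m (mat_adjoint X * Y * X)"
proof -
  have Yc: "Y \<in> carrier_mat n n" and hY: "mat_adjoint Y = Y"
    using Y by (auto simp: positive_semidefinite_def hermitian_mat_def)
  note X' = mat_adjoint_carrier[OF X]
  have XY: "mat_adjoint X * Y \<in> carrier_mat m n" using X' Yc by simp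
  have "mat_adjoint (mat_adjoint X * Y * X) = mat_adjoint X * Y * X"
    unfolding mat_adjoint_mult[OF XY X] mat_adjoint_mult[OF X' Yc] hY mat_adjoint_adjoint
    using X' X Yc by (simp add: assoc_mult_mat[OF X' Yc X])
  moreover have "0 \<le> Re ((mat_adjoint X * Y * X *\<^sub>v v) \<bullet>c v)" if v: "v \<in> carrier_vec m" for v
  proof -
    have Xv: "X *\<^sub>v v \<in> carrier_vec n" using X v by simp
    have "mat_adjoint X * Y * X *\<^sub>v v = mat_adjoint X *\<^sub>v (Y *\<^sub>v (X *\<^sub>v v))"
      using v X X' Yc XY
      by (simp add: assoc_mult_mat_vec[of _ m n _ n] assoc_mult_mat_vec[of _ m n _ m])
    hence "(mat_adjoint X * Y * X *\<^sub>v v) \<bullet>c v = (Y *\<^sub>v (X *\<^sub>v v)) \<bullet>c (X *\<^sub>v v)"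
      using cscalar_prod_adjoint[OF X' _ v] Xv Yc by simp
    thus ?thesis using Y Xv by (simp add: positive_semidefinite_def)
  qed
  ultimately show ?thesis
    using XY X by (auto simp: positive_semidefinite_def hermitian_mat_def)
qed

lemma psd_mat_diag_iff:
  "positive_semidefinite n (mat_diag n (\<lambda>i. complex_of_real (d i))) \<longleftrightarrow> (\<forall>i<n. 0 \<le> d i)"
proof -
  define D where "D = mat_diag n (\<lambda>i. complex_of_real (d i))"
  have D: "D \<in> carrier_mat n n" by (simp add: D_def)
  have Dv: "(D *\<^sub>v v) \<bullet>c v = (\<Sum>i<n. complex_of_real (d i) * (v $ i * cnj (v $ i)))"
    if "v \<in> carrier_vec n" for v
  proof -
    have "(D *\<^sub>v v) $ i = d i * v $ i" if i: "i < n" for i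
    proof -
      have "(D *\<^sub>v v) $ i = (\<Sum>j<n. (if i = j then complex_of_real (d j) else 0) * v $ j)"
        using i \<open>v \<in> carrier_vec n\<close>
        by (simp add: D_def mat_diag_def scalar_prod_def atLeast0LessThan)
      also have "\<dots> = (\<Sum>j<n. if j = i then d i * v $ i else 0)"
        by (intro sum.cong) auto
      finally have "(D *\<^sub>v v) $ i = (\<Sum>j<n. if j = i then d i * v $ i else 0)" .
      thus ?thesis using i by simp
    qed
    thus ?thesis using that D by (simp add: scalar_prod_def atLeast0LessThan mult.assoc)
  qed
  have nonneg: "0 \<le> Re ((D *\<^sub>v v) \<bullet>c v)" if "\<forall>i<n. 0 \<le> d i" "v \<in> carrier_vec n" for v
    unfolding Dv[OF that(2)] complex_mult_cnj using that(1) by (auto intro!: sum_nonneg)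
  have "Re ((D *\<^sub>v unit_vec n i) \<bullet>c unit_vec n i) = d i" if "i < n" for i
  proof -
    have "(D *\<^sub>v unit_vec n i) \<bullet>c unit_vec n i =
      (\<Sum>j<n. complex_of_real (d j) * (unit_vec n i $ j * cnj (unit_vec n i $ j)))"
      by (rule Dv) simp
    also have "\<dots> = (\<Sum>j<n. if j = i then complex_of_real (d i) else 0)"
      using that by (intro sum.cong) auto
    finally have "(D *\<^sub>v unit_vec n i) \<bullet>c unit_vec n i = (\<Sum>j<n. if j = i then complex_of_real (d i) else 0)" .
    thus ?thesis using that by simp
  qed
  hence "0 \<le> d i" if "positive_semidefinite n D" "i < n" for i
    using that by (metis positive_semidefinite_def unit_vec_carrier)
  with nonneg show ?thesis
    using mat_adjoint_diag_real[of n d]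
    by (auto simp: positive_semidefinite_def hermitian_mat_def D_def)
qed

text \<open>The eigenvalues are nonnegative because the diagonal factor is itself a congruence
  \<open>U\<^sup>* A U\<close> of \<open>A\<close>.\<close>

lemma psd_spectral_decomposition:
  assumes "positive_semidefinite n A"
  obtains U d where "spectral_decomposition A U d" "\<forall>i<n. 0 \<le> d i"
proof -
  have A: "A \<in> carrier_mat n n" and "hermitian_mat A"
    using assms by (auto simp: positive_semidefinite_def)
  then obtain U d where dec: "spectral_decomposition A U d"
    using hermitian_spectral_decomposition by blast
  define D where "D = mat_diag n (\<lambda>i. complex_of_real (d i))"
  have D: "D \<in> carrier_mat n n" by (simp add: D_def)
  have "unitary_mat n U" and Aeq: "A = U * D * mat_adjoint U"
    using dec A by (auto simp: spectral_decomposition_def D_def)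
  note U = unitary_matD[OF this(1)]
  note U' = mat_adjoint_carrier[OF U(1)]
  have "mat_adjoint U * A * U = (mat_adjoint U * U) * D * (mat_adjoint U * U)"
    unfolding Aeq using U(1) U' D
    by (simp only: assoc_mult_mat[of _ n n _ n _ n] mult_carrier_mat[of _ n n])
  also have "\<dots> = D" using D U by simp
  finally have "positive_semidefinite n D"
    using psd_congruence[OF assms U(1)] by simp
  hence "\<forall>i<n. 0 \<le> d i" by (simp add: D_def psd_mat_diag_iff)
  with dec show ?thesis by (rule that)
qed

lemma spectral_decomposition_powr:
  assumes A: "A \<in> carrier_mat n n" and dec: "spectral_decomposition A U d"
  shows "spectral_decomposition (mat_powr A s) U (\<lambda>i. d i powr s)"
proof -
  have "unitary_mat n U" using dec A by (auto simp: spectral_decomposition_def)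
  moreover have "dim_row (mat_powr A s) = n"
    using unitary_matD(1)[OF calculation] by (simp add: mat_powr_eq[OF dec])
  ultimately show ?thesis using A
    by (simp add: spectral_decomposition_def mat_powr_eq[OF dec])
qed

lemma psd_mat_powr:
  assumes "positive_semidefinite n A"
  shows "positive_semidefinite n (mat_powr A s)"
proof -
  have A: "A \<in> carrier_mat n n" using assms by (simp add: positive_semidefinite_def)
  obtain U d where dec: "spectral_decomposition A U d"
    using psd_spectral_decomposition[OF assms] by blast
  have U: "U \<in> carrier_mat n n"
    using dec A by (auto simp: spectral_decomposition_def unitary_mat_def)
  show ?thesis
    using psd_congruence[of n _ "mat_adjoint U" n] mat_adjoint_carrier[OF U]
      psd_mat_diag_iff[of n "\<lambda>i. d i powr s"] A
    by (simp add: mat_powr_eq[OF dec])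
qed

lemma psd_mat_powr_carrier [simp]:
  "positive_semidefinite n A \<Longrightarrow> mat_powr A s \<in> carrier_mat n n"
  using psd_mat_powr by (auto simp: positive_semidefinite_def)

lemma psd_mat_powr_adjoint [simp]:
  "positive_semidefinite n A \<Longrightarrow> mat_adjoint (mat_powr A s) = mat_powr A s"
  using psd_mat_powr by (auto simp: positive_semidefinite_def hermitian_mat_def)

lemma psd_mat_powr_add:
  assumes "positive_semidefinite n A"
  shows "mat_powr A s * mat_powr A u = mat_powr A (s + u)"
proof -
  have A: "A \<in> carrier_mat n n" using assms by (simp add: positive_semidefinite_def)
  obtain U d where dec: "spectral_decomposition A U d"
    using psd_spectral_decomposition[OF assms] by blast
  define D where "D s = mat_diag n (\<lambda>i. complex_of_real (d i powr s))" for s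
  have D: "D s \<in> carrier_mat n n" for s by (simp add: D_def)
  have DD: "D s * D u = D (s + u)" by (simp add: D_def powr_add)
  have "unitary_mat n U" using dec A by (auto simp: spectral_decomposition_def)
  note U = unitary_matD[OF this]
  note U' = mat_adjoint_carrier[OF U(1)]
  have pw: "mat_powr A s = U * D s * mat_adjoint U" for s
    using A by (simp add: mat_powr_eq[OF dec] D_def)
  have "mat_powr A s * mat_powr A u = U * D s * (mat_adjoint U * U) * D u * mat_adjoint U"
    unfolding pw using U(1) U' D
    by (simp only: assoc_mult_mat[of _ n n _ n _ n] mult_carrier_mat[of _ n n])
  also have "\<dots> = U * (D s * D u) * mat_adjoint U"
    using U(1) U' D right_mult_one_mat[OF mult_carrier_mat[OF U(1) D]]
    by (simp add: U(2) assoc_mult_mat[of _ n n _ n _ n, symmetric] mult_carrier_mat[of _ n n])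
  finally show ?thesis by (simp add: DD pw)
qed

lemma psd_mat_powr_mat_powr:
  assumes "positive_semidefinite n A"
  shows "mat_powr (mat_powr A s) u = mat_powr A (s * u)"
proof -
  have A: "A \<in> carrier_mat n n" using assms by (simp add: positive_semidefinite_def)
  obtain U d where dec: "spectral_decomposition A U d"
    using psd_spectral_decomposition[OF assms] by blast
  have "dim_row (mat_powr A s) = n" using psd_mat_powr_carrier[OF assms] by blast
  thus ?thesis using A
    by (simp add: mat_powr_eq[OF spectral_decomposition_powr[OF A dec, of s], of u]
        mat_powr_eq[OF dec, of "s * u"] powr_powr)
qed

lemma psd_mat_powr_1:
  assumes "positive_semidefinite n A"
  shows "mat_powr A 1 = A"
proof -
  have A: "A \<in> carrier_mat n n" using assms by (simp add: positive_semidefinite_def)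
  obtain U d where dec: "spectral_decomposition A U d" and d: "\<forall>i<n. 0 \<le> d i"
    using psd_spectral_decomposition[OF assms] by blast
  have "mat_diag n (\<lambda>i. complex_of_real (d i powr 1)) = mat_diag n (\<lambda>i. complex_of_real (d i))"
    using d by (intro eq_matI) (auto simp: mat_diag_def)
  thus ?thesis using dec A by (simp add: mat_powr_eq[OF dec]) (simp add: spectral_decomposition_def)
qed

text \<open>The square \<open>Y\<close> is the power \<open>2\<close> of \<open>X\<close> in the functional calculus of \<open>X\<close>, where powers of powers
  multiply; hence uniqueness of the square root costs nothing beyond the independence of
  \<open>mat_powr\<close> from the chosen decomposition.\<close>

lemma psd_sqrt_unique:
  assumes "positive_semidefinite n X" "X * X = Y"
  shows "mat_powr Y (1/2) = X"
proof -
  have "Y = mat_powr X 2"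
    using psd_mat_powr_add[OF assms(1), of 1 1] assms by (simp add: psd_mat_powr_1)
  thus ?thesis using assms(1) by (simp add: psd_mat_powr_mat_powr psd_mat_powr_1)
qed

lemma psd_support_proj:
  assumes "positive_semidefinite n A"
  shows "support_proj A * mat_powr A s = mat_powr A s" "mat_powr A s * support_proj A = mat_powr A s"
    "support_proj A * A = A" "A * support_proj A = A"
    and "mat_adjoint (support_proj A) = support_proj A" "support_proj A \<in> carrier_mat n n"
  using psd_mat_powr_add[OF assms, of 0 1] psd_mat_powr_add[OF assms, of 1 0]
  by (simp_all add: support_proj_def psd_mat_powr_add[OF assms] psd_mat_powr_1[OF assms]
      psd_mat_powr_adjoint[OF assms] psd_mat_powr_carrier[OF assms])

lemma psd_powr_congruence:
  assumes A: "positive_semidefinite n A" and B: "positive_semidefinite n B"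
  shows "positive_semidefinite n (mat_powr A s * B * mat_powr A s)"
  using psd_congruence[OF B, of "mat_powr A s" n] A by simp

section \<open>The geometric mean and the symmetry of the spectral mean\<close>

lemma geometric_mean_inverse:
  assumes "positive_semidefinite n A"
  shows "geometric_mean (mat_powr A (-1)) B =
    mat_powr A (-1/2) * mat_powr (mat_powr A (1/2) * B * mat_powr A (1/2)) (1/2) * mat_powr A (-1/2)"
  using assms by (simp add: geometric_mean_def psd_mat_powr_mat_powr)

text \<open>With \<open>a = A^(1/2)\<close> and \<open>M = (a B a)^(1/2)\<close> the mean is \<open>G = a^(-1) M a^(-1)\<close>.  The factors
  between the two copies of \<open>M\<close> in \<open>G A G\<close> cancel to the support projection, which \<open>M\<close> absorbs,
  so that \<open>M^2 = a B a\<close> remains.  If \<open>A\<close> is singular, only the compression of \<open>B\<close> to its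
  support is recovered.\<close>

lemma geometric_mean_inverse_riccati:
  assumes A: "positive_semidefinite n A" and B: "positive_semidefinite n B"
  defines "G \<equiv> geometric_mean (mat_powr A (-1)) B"
  shows "positive_semidefinite n G" "support_proj A * G = G"
    "G * A * G = support_proj A * B * support_proj A"
proof -
  define a a' P where "a = mat_powr A (1/2)" and "a' = mat_powr A (-1/2)" and "P = support_proj A"
  have c [simp]: "A \<in> carrier_mat n n" "B \<in> carrier_mat n n"
    "a \<in> carrier_mat n n" "a' \<in> carrier_mat n n" "P \<in> carrier_mat n n"
    using A B by (simp_all add: a_def a'_def P_def psd_support_proj positive_semidefinite_def)
  note [simp] = mult_carrier_mat[of _ n n]
  note ac = assoc_mult_mat[of _ n n _ n _ n]
  have aa: "a * a = A" "a' * a = P" "a * a' = P"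
    using A by (simp_all add: a_def a'_def P_def support_proj_def psd_mat_powr_add psd_mat_powr_1)
  have P: "P * a = a" "P * a' = a'" "P * P = P"
    using A by (simp_all add: a_def a'_def P_def support_proj_def psd_mat_powr_add)

  define Y where "Y = a * B * a"
  have Y: "positive_semidefinite n Y"
    using A B by (simp add: Y_def a_def psd_powr_congruence)
  define M where "M = mat_powr Y (1/2)"
  have M: "positive_semidefinite n M" "M \<in> carrier_mat n n" "M * M = Y"
    using Y by (simp_all add: M_def psd_mat_powr psd_mat_powr_add psd_mat_powr_1)
  have PM: "P * M = M"
  proof -
    have Yc: "Y \<in> carrier_mat n n" "mat_powr Y (-1/2) \<in> carrier_mat n n"
      using Y by (simp_all add: positive_semidefinite_def)
    have MY: "M = Y * mat_powr Y (-1/2)"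
      using psd_mat_powr_add[OF Y, of 1 "-1/2"] by (simp add: M_def psd_mat_powr_1[OF Y])
    have "P * Y = (P * a) * B * a" by (simp add: Y_def ac)
    hence "P * Y = Y" by (simp add: P Y_def)
    thus ?thesis using Yc by (simp add: MY flip: ac)
  qed

  have G: "G = a' * M * a'"
    using A by (simp add: G_def geometric_mean_inverse M_def Y_def a_def a'_def)
  show "positive_semidefinite n G"
    unfolding G a'_def by (rule psd_powr_congruence[OF A M(1)])
  have "P * G = (P * a') * M * a'" using M(2) by (simp add: G ac)
  thus "support_proj A * G = G" by (simp add: P G flip: P_def)
  have "G * A * G = a' * M * (a' * a) * (a * a') * M * a'"
    using M(2) by (simp add: G ac flip: aa(1))
  also have "\<dots> = a' * M * (P * P) * M * a'"
    using M(2) by (simp only: aa ac c mult_carrier_mat[of _ n n])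
  also have "\<dots> = a' * M * (P * M) * a'"
    using M(2) by (simp only: P ac c mult_carrier_mat[of _ n n])
  also have "\<dots> = a' * (M * M) * a'"
    using M(2) by (simp only: PM ac c mult_carrier_mat[of _ n n])
  also have "\<dots> = (a' * a) * B * (a * a')"
    by (simp add: M(3) Y_def ac)
  finally show "G * A * G = support_proj A * B * support_proj A"
    by (simp only: aa P_def)
qed

text \<open>The mean for the exchanged pair is the inverse \<open>K\<close> of \<open>G\<close> on its support, because both have
  the same compression \<open>b K b\<close> by the square root \<open>b\<close> of \<open>B\<close>.  Commutation of \<open>P\<close> and \<open>Q\<close>
  makes the support of \<open>G\<close> equal to \<open>P Q\<close>, and so lets \<open>K\<close> undo the Riccati equation of \<open>G\<close>.\<close>

theorem psd_spectral_mean_commute: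
  assumes A: "positive_semidefinite n A" and B: "positive_semidefinite n B"
    and commute: "support_proj A * support_proj B = support_proj B * support_proj A"
  shows "spectral_mean t A B = spectral_mean (1 - t) B A"
proof -
  define a a' P where "a = mat_powr A (1/2)" and "a' = mat_powr A (-1/2)" and "P = support_proj A"
  define b b' Q where "b = mat_powr B (1/2)" and "b' = mat_powr B (-1/2)" and "Q = support_proj B"
  have c [simp]: "A \<in> carrier_mat n n" "B \<in> carrier_mat n n"
    "a \<in> carrier_mat n n" "a' \<in> carrier_mat n n" "P \<in> carrier_mat n n"
    "b \<in> carrier_mat n n" "b' \<in> carrier_mat n n" "Q \<in> carrier_mat n n"
    using A B by (simp_all add: a_def a'_def P_def b_def b'_def Q_def psd_support_proj
        positive_semidefinite_def)
  have adj: "mat_adjoint a = a" "mat_adjoint P = P" "mat_adjoint b = b" "mat_adjoint Q = Q"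
    using A B by (simp_all add: a_def P_def b_def Q_def psd_support_proj)
  have aa: "a * a = A" "a' * a = P"
    using A by (simp_all add: a_def a'_def P_def support_proj_def psd_mat_powr_add psd_mat_powr_1)
  have bb: "b * b = B" "b' * b = Q" "b * b' = Q"
    using B by (simp_all add: b_def b'_def Q_def support_proj_def psd_mat_powr_add psd_mat_powr_1)
  have P: "P * A = A" "A * P = A" and Q: "B * Q = B" "Q * b = b" "b * Q = b"
    using A B by (simp_all add: P_def Q_def b_def psd_support_proj)
  have PQ: "P * Q = Q * P" using commute by (simp add: P_def Q_def)
  note mc = mult_carrier_mat[of _ n n]
  note ac = assoc_mult_mat[of _ n n _ n _ n]

  define G where "G = geometric_mean (mat_powr A (-1)) B"
  have G: "positive_semidefinite n G" and PG: "P * G = G" and riccati: "G * A * G = P * B * P"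
    using geometric_mean_inverse_riccati[OF A B] by (simp_all add: G_def P_def)
  have Gc [simp]: "G \<in> carrier_mat n n" and adjG: "mat_adjoint G = G"
    using G by (auto simp: positive_semidefinite_def hermitian_mat_def)
  define K where "K = mat_powr G (-1)"
  define S where "S = support_proj G"
  have KS [simp]: "K \<in> carrier_mat n n" "S \<in> carrier_mat n n"
    and adjS: "mat_adjoint S = S"
    using G by (simp_all add: K_def S_def psd_support_proj)
  have GK: "G * K = S" "K * G = S"
    using psd_mat_powr_add[OF G, of 1 "-1"] psd_mat_powr_add[OF G, of "-1" 1]
    by (simp_all add: K_def S_def support_proj_def psd_mat_powr_1[OF G])
  have S: "G * S = G" "K * S = K" "S * K = K"
    using G by (simp_all add: S_def K_def psd_support_proj)

  \<comment> \<open>\<open>P\<close> preserves the kernel of \<open>Q\<close>, so \<open>P B P = G A G\<close> vanishes there, and with it \<open>a G\<close>.\<close>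
  have GQ: "G * Q = G"
  proof -
    have "mat_adjoint (a * G) * (a * G) = P * B * P"
      by (simp add: mat_adjoint_mult[of _ n n _ n] adj adjG mc ac flip: riccati aa(1))
    moreover have "P * B * P * Q = P * (B * Q) * P"
      by (simp add: ac mc PQ)
    ultimately have "a * G * Q = a * G"
      by - (rule mult_eq_if_adjoint_mult_self_eq[of _ n n], simp_all add: mc Q)
    hence "a' * a * G * Q = a' * a * G"
      by (simp add: ac mc)
    thus ?thesis by (simp add: aa PG)
  qed
  have GP: "G * P = G"
    using arg_cong[OF PG, of mat_adjoint] by (simp add: mat_adjoint_mult[of _ n n _ n] adj adjG)
  have SPQ: "S * P = S" "S * Q = S"
    using GP GQ by (simp_all add: ac mc flip: GK(2))

  \<comment> \<open>Conversely, \<open>G A G = P B P\<close> vanishes on the kernel of \<open>G\<close>, and with it \<open>b P\<close> and \<open>Q P\<close>.\<close>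
  have S_eq: "S = P * Q"
  proof -
    have "mat_adjoint (b * P) * (b * P) = P * B * P"
      by (simp add: mat_adjoint_mult[of _ n n _ n] adj mc ac flip: bb(1))
    moreover have "P * B * P * S = P * B * P"
      unfolding riccati[symmetric] by (simp add: ac mc S)
    ultimately have "b * P * S = b * P"
      by - (rule mult_eq_if_adjoint_mult_self_eq[of _ n n], simp_all add: mc)
    hence "b' * b * P * S = b' * b * P"
      by (simp add: ac mc)
    hence "mat_adjoint (Q * P * S) = mat_adjoint (Q * P)"
      by (simp add: bb)
    hence "S * P * Q = P * Q"
      by (simp add: mat_adjoint_mult[of _ n n _ n] adj adjS mc ac)
    thus ?thesis by (simp add: SPQ)
  qed

  have KP: "K * P = K" "P * K = K"
  proof -
    have "K * S * P = K * S" by (simp add: ac mc SPQ)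
    thus "K * P = K" by (simp add: S)
    have "P * S = S"
      using arg_cong[OF SPQ(1), of mat_adjoint] by (simp add: mat_adjoint_mult[of _ n n _ n] adj adjS)
    hence "P * S * K = S * K" by simp
    thus "P * K = K" by (simp add: S ac)
  qed
  \<comment> \<open>The Riccati equation for the exchanged pair, solved by \<open>K\<close>.\<close>
  have KBK: "K * B * K = Q * A * Q"
  proof -
    have "K * B * K = (K * P) * B * (P * K)" by (simp only: KP)
    also have "\<dots> = K * (P * B * P) * K" by (simp add: ac mc)
    also have "\<dots> = (K * G) * A * (G * K)" by (simp add: ac mc flip: riccati)
    also have "\<dots> = (Q * P) * A * (P * Q)" by (simp only: GK S_eq PQ)
    also have "\<dots> = Q * (P * A * P) * Q" by (simp add: ac mc)
    finally show ?thesis by (simp add: P)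
  qed

  have H: "geometric_mean (mat_powr B (-1)) A = K"
  proof -
    have "positive_semidefinite n (b * K * b)"
      unfolding b_def by (rule psd_powr_congruence[OF B]) (simp add: K_def psd_mat_powr[OF G])
    moreover have "(b * K * b) * (b * K * b) = b * A * b"
    proof -
      have "(b * K * b) * (b * K * b) = b * (K * (b * b) * K) * b" by (simp add: ac mc)
      also have "\<dots> = b * (Q * A * Q) * b" by (simp only: bb KBK)
      also have "\<dots> = (b * Q) * A * (Q * b)" by (simp add: ac mc)
      finally show ?thesis by (simp add: Q)
    qed
    ultimately have "mat_powr (b * A * b) (1/2) = b * K * b" by (rule psd_sqrt_unique)
    hence "geometric_mean (mat_powr B (-1)) A = b' * (b * K * b) * b'"
      by (simp add: geometric_mean_inverse[OF B] b_def b'_def)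
    also have "\<dots> = (b' * b) * K * (b * b')" by (simp add: ac mc)
    also have "\<dots> = Q * K * Q" by (simp only: bb)
    also have "\<dots> = K"
    proof -
      have "K * S * Q = K * S" by (simp add: ac mc SPQ)
      hence "K * Q = K" by (simp add: S)
      moreover from arg_cong[OF this, of mat_adjoint] have "Q * K = K"
        using G by (simp add: mat_adjoint_mult[of _ n n _ n] adj K_def)
      ultimately show ?thesis by simp
    qed
    finally show ?thesis .
  qed

  define g where "g = mat_powr G t"
  have g: "g \<in> carrier_mat n n" "g * S = g" "S * g = g"
    using G by (simp_all add: g_def S_def psd_support_proj)
  have gQ: "g * Q = g"
  proof -
    have "g * S * Q = g * S" using g(1) by (simp add: ac mc SPQ)
    thus ?thesis by (simp add: g)
  qed
  have Qg: "Q * g = g"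
    using arg_cong[OF gQ, of mat_adjoint] g(1) G
    by (simp add: mat_adjoint_mult[of _ n n _ n] adj) (simp add: g_def)
  have Kg: "mat_powr K (1 - t) = g * K" "mat_powr K (1 - t) = K * g"
    using psd_mat_powr_add[OF G, of t "-1"] psd_mat_powr_add[OF G, of "-1" t]
    by (simp_all add: K_def g_def psd_mat_powr_mat_powr[OF G] algebra_simps)
  have "spectral_mean (1 - t) B A = mat_powr K (1 - t) * B * mat_powr K (1 - t)"
    by (simp add: spectral_mean_def H Let_def)
  also have "\<dots> = (g * K) * B * (K * g)" by (simp only: flip: Kg)
  also have "\<dots> = g * (K * B * K) * g" using g(1) by (simp add: ac mc)
  also have "\<dots> = (g * Q) * A * (Q * g)" using g(1) by (simp only: KBK ac mc c)
  also have "\<dots> = g * A * g" by (simp only: gQ Qg)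
  also have "\<dots> = spectral_mean t A B"
    by (simp add: spectral_mean_def G_def g_def Let_def)
  finally show ?thesis ..
qed

theorem proposition3p3:
  fixes n :: nat and t :: real and \<rho> \<sigma> :: "complex mat"
  assumes "t \<in> {0..1}"
    and "density_operator n \<rho>" and "density_operator n \<sigma>"
    and "support_proj \<rho> * support_proj \<sigma> = support_proj \<sigma> * support_proj \<rho>"
  shows "spectral_mean t \<rho> \<sigma> = spectral_mean (1 - t) \<sigma> \<rho>
    \<and> spectral_fidelity t \<rho> \<sigma> = spectral_fidelity (1 - t) \<sigma> \<rho>"
proof -
  have "spectral_mean t \<rho> \<sigma> = spectral_mean (1 - t) \<sigma> \<rho>"
    using assms by (intro psd_spectral_mean_commute) (auto simp: density_operator_def)
  thus ?thesis by (simp add: spectral_fidelity_def)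
qed

end
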